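(* Let $q \geq 1$ be an integer and let $\epsilon \in [\frac{1}{11},\frac{1}{2})$ be a real number. Let $p$ be a prime satisfying $$ p\equiv 1\pmod{q}, \qquad \log\log p > \frac{\log 6.83}{\frac{1}{2}-\epsilon} \qquad \text{and} \qquad \frac{\phi(p-1)}{p-1}\leq\frac{1}{2}-\epsilon . $$ Then there exists an integer $g$ satisfying $1 < g < p-1$ and $\gcd\left(g,\frac{p-1}{q}\right)=1$ such that $g$ is a QNRNP modulo $p$. In particular, when $q=1$, there exists an integer $g$ with $1<g<p-1$ and $\gcd(g,p-1)=1$ such that $g$ is a QNRNP modulo $p$.
   Context: For an odd prime $p$, a primitive root modulo $p$ is an integer whose class generates the cyclic group $(\mathbb{Z}/p\mathbb{Z})^*$. An integer is called a QNRNP modulo $p$ if it is a quadratic non-residue modulo $p$ (in particular coprime to $p$) which is not a primitive root modulo $p$. Here $\phi$ is Euler's totient function and $\log$ is the natural logarithm. *)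

theory Defs
  imports "HOL-Analysis.Analysis" "HOL-Number_Theory.Number_Theory"
begin

(* residue_primroot lives on nat, so the integer g is replaced by its least
   nonnegative residue; primroot_mod_iff_generates relates this to generating
   the group of units modulo p. *)
definition primroot_mod :: "nat \<Rightarrow> int \<Rightarrow> bool" where
  "primroot_mod p g \<longleftrightarrow> residue_primroot p (nat (g mod int p))"

(* The coprimality conjunct is redundant, since QuadRes counts the multiples
   of p as residues. *)
definition QNRNP :: "nat \<Rightarrow> int \<Rightarrow> bool" where
  "QNRNP p g \<longleftrightarrow> coprime g (int p) \<and> \<not> QuadRes (int p) g \<and> \<not> primroot_mod p g"

lemma primroot_mod_iff_generates:
  assumes "prime p"
  shows "primroot_mod p g \<longleftrightarrow>
    coprime g (int p) \<and> (\<forall>a. coprime a (int p) \<longrightarrow> (\<exists>k::nat. [g ^ k = a] (mod int p)))"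
proof -
  define h where "h = nat (g mod int p)"
  have p1: "p > 1" using assms prime_gt_1_nat by auto
  have hg: "[int h = g] (mod int p)"
    using p1 by (simp add: h_def cong_def)
  have cop: "coprime g (int p) \<longleftrightarrow> coprime p h"
    using cong_imp_coprime[OF hg] cong_imp_coprime[OF cong_sym[OF hg]]
    by (auto simp: coprime_commute coprime_int_iff)
  show ?thesis
  proof
    assume "primroot_mod p g"
    then have pr: "residue_primroot p h" by (simp add: primroot_mod_def h_def)
    then have c: "coprime p h" by (simp add: residue_primroot_def)
    have "\<exists>k::nat. [g ^ k = a] (mod int p)" if a: "coprime a (int p)" for a
    proof -
      define b where "b = nat (a mod int p)"
      have ba: "[int b = a] (mod int p)" using p1 by (simp add: b_def cong_def)
      have "coprime (int b) (int p)"
        using cong_imp_coprime[OF cong_sym[OF ba]] a by blast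
      then have cb: "coprime b p" by (simp add: coprime_int_iff)
      have "b < p" using p1 by (simp add: b_def nat_less_iff)
      moreover have "b \<noteq> 0" using cb p1 by (intro notI) simp
      ultimately have "b \<in> totatives p" using cb by (auto simp: totatives_def)
      then have "b \<in> (\<lambda>i. h ^ i mod p) ` {..<totient p}"
        using residue_primroot_is_generator[OF p1 pr] by (simp add: bij_betw_def)
      then obtain i where "b = h ^ i mod p" by blast
      then have "[h ^ i = b] (mod p)" by (simp add: cong_def)
      then have "[int h ^ i = int b] (mod int p)"
        by (metis cong_int_iff of_nat_power)
      then have "[g ^ i = a] (mod int p)"
        using ba hg by (meson cong_pow cong_sym cong_trans)
      then show ?thesis by blast
    qed
    then show "coprime g (int p) \<and> (\<forall>a. coprime a (int p) \<longrightarrow> (\<exists>k::nat. [g ^ k = a] (mod int p)))"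
      using c cop by blast
  next
    assume A: "coprime g (int p) \<and> (\<forall>a. coprime a (int p) \<longrightarrow> (\<exists>k::nat. [g ^ k = a] (mod int p)))"
    then have c: "coprime p h" using cop by blast
    have o: "ord p h > 0" using c by (simp add: coprime_commute)
    have "totatives p \<subseteq> (\<lambda>i. h ^ i mod p) ` {..<ord p h}"
    proof
      fix b assume b: "b \<in> totatives p"
      then have cb: "coprime (int b) (int p)" and "b \<le> p" 
        by (auto simp: totatives_def coprime_int_iff)
      have "b \<noteq> p" using b p1 by (auto simp: totatives_def)
      then have "b < p" using \<open>b \<le> p\<close> by simp
      obtain k where "[g ^ k = int b] (mod int p)" using A cb by blast
      then have "[int h ^ k = int b] (mod int p)"
        using hg by (meson cong_pow cong_trans)
      then have "[h ^ k = b] (mod p)" by (metis cong_int_iff of_nat_power)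
      moreover have "[h ^ k = h ^ (k mod ord p h)] (mod p)"
        using c order_divides_expdiff[of p h k "k mod ord p h"] by (simp add: cong_def)
      ultimately have "b = h ^ (k mod ord p h) mod p"
        using \<open>b < p\<close> by (simp add: cong_def)
      then show "b \<in> (\<lambda>i. h ^ i mod p) ` {..<ord p h}" using o by auto
    qed
    then have "card (totatives p) \<le> card {..<ord p h}"
      by (meson card_image_le card_mono finite_imageI finite_lessThan le_trans)
    then have "totient p \<le> ord p h" by (simp add: totient_def)
    moreover have "ord p h \<le> totient p"
      using order_divides_totient[OF c] p1 by (intro dvd_imp_le) auto
    ultimately show "primroot_mod p g"
      using c p1 by (simp add: primroot_mod_def residue_primroot_def h_def)
  qed
qed

end

theory Submission
  imports Defs
begin

text \<open>
  Let \<open>n = p - 1\<close>, let \<open>a\<close> be a primitive root modulo \<open>p\<close>, and let \<open>l\<close> be the least odd prime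
  factor of \<open>n\<close>; the hypothesis on \<open>\<phi>(n)/n\<close> makes \<open>l\<close> exist and be \<open>O(log p)\<close>. The elements
  \<open>a^l * (a^(2l))^j\<close> form a coset of a subgroup of index \<open>2l\<close>, and they are non-residues that
  are \<open>l\<close>-th powers, hence not primitive roots. Finite Fourier analysis modulo \<open>p\<close> shows that the
  coset is equidistributed in multiples of \<open>d\<close> up to \<open>n\<close> with error at most
  \<open>sqrt p * (1 + ln p)\<close> for each \<open>d\<close> dividing \<open>n\<close>; inclusion-exclusion over the squarefree such
  \<open>d\<close> then gives at least \<open>\<phi>(n) n / (2 l p) - 2^\<omega>(n) sqrt p (1 + ln p)\<close> elements coprime to
  \<open>n\<close>. This is positive, because \<open>\<phi>(n) / 2^\<omega>(n)\<close> is at least \<open>n^(3/4) / 27\<close> and the hypothesis on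
  \<open>ln (ln p)\<close> forces \<open>ln p \<ge> 100\<close>.
\<close>

section \<open>Additive characters modulo \<open>p\<close>, orthogonality and Parseval's
  identity\<close>

definition add_char :: "nat \<Rightarrow> int \<Rightarrow> complex" where
  "add_char p x = cis (2 * pi * real_of_int x / real p)"

lemma norm_add_char [simp]: "cmod (add_char p x) = 1"
  by (simp add: add_char_def)

lemma add_char_0 [simp]: "add_char p 0 = 1"
  by (simp add: add_char_def)

lemma add_char_add: "add_char p (x + y) = add_char p x * add_char p y"
  by (simp add: add_char_def cis_mult ring_distribs add_divide_distrib)

lemma cnj_add_char: "cnj (add_char p x) = add_char p (- x)"
  by (simp add: add_char_def cis_cnj)

lemma add_char_power: "add_char p x ^ k = add_char p (int k * x)"
  by (simp add: add_char_def Complex.DeMoivre mult_ac)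

lemma add_char_mult_self:
  assumes "p > 0"
  shows "add_char p (int p * k) = 1"
proof -
  have "2 * pi * real_of_int (int p * k) / real p = real_of_int k * 2 * pi"
    using assms by simp
  then show ?thesis
    using cos_int_2pin[of k] sin_int_2pin[of k]
    by (simp add: add_char_def complex_eq_iff mult_ac)
qed

lemma add_char_cong:
  assumes "p > 0" "[x = y] (mod int p)"
  shows "add_char p x = add_char p y"
proof -
  obtain k where "x = y + int p * k"
    using assms(2) by (metis cong_iff_lin cong_sym)
  then show ?thesis
    using assms(1) by (simp add: add_char_add add_char_mult_self)
qed

text \<open>Jordan's inequality: the sine is concave on [0, pi/2] and so lies above its chord. It
  will bound the denominator of a geometric sum from below by a linear function of the
  frequency.\<close>

lemma sin_pi_ge:
  assumes "0 \<le> s" "s \<le> 1/2"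
  shows "2 * s \<le> sin (pi * s)"
proof -
  have "convex_on {0..pi/2} (\<lambda>x. - sin x)"
  proof (rule f''_ge0_imp_convex)
    show "((\<lambda>x. - sin x) has_real_derivative - cos x) (at x)" for x :: real
      by (auto intro!: derivative_eq_intros)
    show "((\<lambda>x. - cos x) has_real_derivative sin x) (at x)" for x :: real
      by (auto intro!: derivative_eq_intros)
    show "0 \<le> sin x" if "x \<in> {0..pi/2}" for x :: real
      using that by (auto intro!: sin_ge_zero)
  qed simp
  from convex_onD[OF this, of "2 * s" 0 "pi/2"] assms show ?thesis
    by (simp add: mult_ac)
qed

lemma add_char_eq_1_iff:
  assumes "p > 0"
  shows "add_char p x = 1 \<longleftrightarrow> int p dvd x"
proof
  assume "add_char p x = 1"
  then have "cos (2 * pi * real_of_int x / real p) = 1"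
    by (simp add: add_char_def complex_eq_iff)
  then obtain n :: int where "2 * pi * real_of_int x / real p = n * 2 * pi"
    unfolding cos_one_2pi_int by auto
  then have "real_of_int x = real_of_int (n * int p)"
    using assms by (simp add: field_simps)
  then have "x = n * int p"
    by (simp only: of_int_eq_iff)
  then show "int p dvd x" by simp
qed (use assms in \<open>auto simp: add_char_mult_self\<close>)

lemma sum_add_char:
  assumes "p > 0"
  shows "(\<Sum>t<p. add_char p (int t * x)) = (if int p dvd x then of_nat p else 0)"
proof (cases "int p dvd x")
  case True
  then have "add_char p (int t * x) = 1" for t
    using assms by (simp add: add_char_eq_1_iff)
  with True show ?thesis by simp
next
  case False
  then have "add_char p x \<noteq> 1"
    using assms by (simp add: add_char_eq_1_iff)
  then have "(\<Sum>t<p. add_char p x ^ t) = (add_char p x ^ p - 1) / (add_char p x - 1)"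
    by (rule geometric_sum)
  also have "add_char p x ^ p = 1"
    using assms by (simp add: add_char_power add_char_mult_self)
  finally show ?thesis
    using False by (simp add: add_char_power)
qed

text \<open>Expanding the square and summing over \<open>t\<close> first leaves, by orthogonality,
  only pairs with \<open>h i\<close> congruent to \<open>h j\<close>; injectivity modulo
  \<open>p\<close> reduces these to the diagonal.\<close>

lemma parseval_add_char:
  fixes h :: "nat \<Rightarrow> int"
  assumes "p > 0" and inj: "\<And>i j. i < N \<Longrightarrow> j < N \<Longrightarrow> [h i = h j] (mod int p) \<Longrightarrow> i = j"
  shows "(\<Sum>t<p. (cmod (\<Sum>j<N. add_char p (int t * h j)))\<^sup>2) = real p * real N"
proof -
  have "complex_of_real (\<Sum>t<p. (cmod (\<Sum>j<N. add_char p (int t * h j)))\<^sup>2) =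
    (\<Sum>t<p. \<Sum>i<N. \<Sum>j<N. add_char p (int t * (h i - h j)))"
  proof (subst of_real_sum, rule sum.cong)
    fix t
    show "complex_of_real ((cmod (\<Sum>j<N. add_char p (int t * h j)))\<^sup>2) =
      (\<Sum>i<N. \<Sum>j<N. add_char p (int t * (h i - h j)))"
      by (simp only: complex_norm_square cnj_sum cnj_add_char sum_product add_char_add[symmetric])
         (simp add: algebra_simps)
  qed simp
  also have "\<dots> = (\<Sum>i<N. \<Sum>j<N. \<Sum>t<p. add_char p (int t * (h i - h j)))"
    by (simp only: sum.swap[where A = "{..<p}"])
  also have "\<dots> = (\<Sum>i<N. \<Sum>j<N. if i = j then of_nat p else 0)"
    using inj assms(1)
    by (intro sum.cong refl) (auto simp: sum_add_char cong_iff_dvd_diff)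
  also have "\<dots> = complex_of_real (real p * real N)"
    by (simp add: sum.delta)
  finally show ?thesis
    by (simp only: of_real_eq_iff)
qed

section \<open>Exponential sums over cosets of a cyclic subgroup and over intervals\<close>

lemma sum_periodic_shift:
  fixes f :: "nat \<Rightarrow> 'a::comm_monoid_add"
  assumes "\<And>j. f (j + N) = f j"
  shows "(\<Sum>j<N. f (j + i)) = (\<Sum>j<N. f j)"
proof (induction i)
  case (Suc i)
  have "(\<Sum>j<N. f (j + Suc i)) + f i = (\<Sum>j<Suc N. f (j + i))"
    by (simp only: sum.lessThan_Suc_shift) (simp add: add_ac)
  also have "\<dots> = (\<Sum>j<N. f (j + i)) + f i"
    using assms[of i] by (simp add: add_ac)
  finally have *: "(\<Sum>j<N. f (j + Suc i)) + f i = (\<Sum>j<N. f (j + i)) + f i" .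
  \<comment> \<open>A commutative monoid offers no cancellation of \<open>f i\<close>, so the last
    summand is split off and replaced by its periodic copy.\<close>
  show ?case
  proof (cases N)
    case (Suc M)
    have "(\<Sum>j<N. f (j + Suc i)) = (\<Sum>j<M. f (j + Suc i)) + f (i + N)"
      using Suc by (simp add: add_ac)
    also have "\<dots> = (\<Sum>j<N. f (j + i))"
      using Suc assms[of i] by (simp add: sum.lessThan_Suc_shift add_ac del: sum.lessThan_Suc)
    finally show ?thesis using Suc.IH by simp
  qed simp
qed simp

text \<open>This makes the enumeration of a coset by exponents below the order free of
  repetitions.\<close>

lemma power_cong_less_ord_imp_eq:
  fixes a g p :: nat
  assumes "coprime g p" "i < ord p g" "j < ord p g" "[a * g ^ i = a * g ^ j] (mod p)" "coprime a p"
  shows "i = j"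
proof -
  have "[g ^ i = g ^ j] (mod p)"
    using assms by (metis cong_mult_lcancel_nat)
  then have "[i = j] (mod ord p g)"
    using order_divides_expdiff[of p g i j] assms(1) by (simp add: coprime_commute)
  then show ?thesis using assms by (simp add: cong_def)
qed

text \<open>
  Multiplying the frequency by a power of \<open>g\<close> only permutes the summands, so the same
  value occurs at \<open>ord p g\<close> frequencies and Parseval's identity bounds it.
\<close>

lemma cmod_coset_sum_le:
  fixes c g :: nat and t :: int
  assumes p: "prime p" and c: "coprime c p" and g: "coprime g p" and t: "\<not> int p dvd t"
  defines "N \<equiv> ord p g"
  shows "cmod (\<Sum>j<N. add_char p (t * int (c * g ^ j))) \<le> sqrt (real p)"
proof -
  have p0: "p > 0" using p prime_gt_0_nat by blast
  have N0: "N > 0" using g by (simp add: N_def coprime_commute)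
  note g_eq = power_cong_less_ord_imp_eq[OF g, folded N_def]
  define S where "S = (\<lambda>u. cmod (\<Sum>j<N. add_char p (u * int (c * g ^ j))))"
  define \<tau> where "\<tau> = nat (t mod int p)"
  have \<tau>: "[int \<tau> = t] (mod int p)"
    using p0 by (simp add: \<tau>_def cong_def)
  have cop: "coprime \<tau> p"
  proof -
    have "\<not> p dvd \<tau>"
      using \<tau> t cong_dvd_iff[OF \<tau>] by (metis cong_dvd_modulus cong_sym cong_0_iff cong_trans int_dvd_int_iff)
    then show ?thesis using p by (metis coprime_commute prime_imp_coprime_nat)
  qed
  \<comment> \<open>The multiplied frequencies are reduced below \<open>p\<close>, so that they form
    a subset of the frequencies over which Parseval's identity sums.\<close>
  define T where "T = (\<lambda>i. (\<tau> * g ^ i) mod p)"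
  have S_shift: "S (int (T i)) = S t" for i
  proof -
    have "(\<Sum>j<N. add_char p (int (T i) * int (c * g ^ j))) =
          (\<Sum>j<N. add_char p (t * int (c * g ^ (j + i))))"
    proof (rule sum.cong)
      fix j
      have "[int (T i) = int (\<tau> * g ^ i)] (mod int p)"
        by (simp only: cong_int_iff) (simp add: T_def cong_def)
      then have "[int (T i) * int (c * g ^ j) = int \<tau> * int (g ^ i) * int (c * g ^ j)] (mod int p)"
        by (simp add: cong_scalar_right)
      also have "[int \<tau> * int (g ^ i) * int (c * g ^ j) = t * int (g ^ i) * int (c * g ^ j)] (mod int p)"
        by (intro cong_scalar_right \<tau>)
      finally have "[int (T i) * int (c * g ^ j) = t * int (c * g ^ (j + i))] (mod int p)"
        by (simp add: power_add mult_ac)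
      then show "add_char p (int (T i) * int (c * g ^ j)) = add_char p (t * int (c * g ^ (j + i)))"
        by (rule add_char_cong[OF p0])
    qed simp
    also have "\<dots> = (\<Sum>j<N. add_char p (t * int (c * g ^ j)))"
    proof (rule sum_periodic_shift)
      fix j
      have "[g ^ (j + N) = g ^ j * 1] (mod p)"
        unfolding power_add N_def by (intro cong_mult cong_refl ord)
      then have "[int (g ^ (j + N)) = int (g ^ j)] (mod int p)"
        by (simp only: cong_int_iff mult_1_right)
      then have "[t * int c * int (g ^ (j + N)) = t * int c * int (g ^ j)] (mod int p)"
        by (rule cong_scalar_left)
      then show "add_char p (t * int (c * g ^ (j + N))) = add_char p (t * int (c * g ^ j))"
        by (intro add_char_cong[OF p0]) (simp add: mult_ac)
    qed
    finally show ?thesis by (simp add: S_def)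
  qed
  have "inj_on T {..<N}"
    using g_eq cop by (intro inj_onI) (auto simp: T_def cong_def)
  then have "real N * (S t)\<^sup>2 = (\<Sum>u\<in>T ` {..<N}. (S (int u))\<^sup>2)"
    by (simp add: sum.reindex S_shift)
  \<comment> \<open>All summands are nonnegative, so the remaining frequencies may be added.\<close>
  also have "\<dots> \<le> (\<Sum>u<p. (S (int u))\<^sup>2)"
    by (rule sum_mono2) (use p0 in \<open>auto simp: T_def\<close>)
  also have "\<dots> = real p * real N"
    unfolding S_def
  proof (rule parseval_add_char[OF p0])
    fix i j assume "i < N" "j < N" "[int (c * g ^ i) = int (c * g ^ j)] (mod int p)"
    then show "i = j" using g_eq[of i j c] c by (simp only: cong_int_iff)
  qed
  finally have "(S t)\<^sup>2 \<le> real p" using N0 by simp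
  then show ?thesis by (simp add: S_def real_le_rsqrt)
qed

text \<open>The geometric sum is at most 2 / |z - 1| = 1 / sin(pi t / p), and the sine is bounded by
  its chord at whichever of t and p - t is smaller. Adding both reciprocals avoids a minimum and
  keeps the bound easy to sum over \<open>t\<close>.\<close>

lemma cmod_interval_sum_le:
  assumes "0 < t" "t < p"
  shows "cmod (\<Sum>m=1..M. add_char p (int t * int m)) \<le> real p / 2 * (1 / real t + 1 / real (p - t))"
proof -
  define z where "z = add_char p (int t)"
  define s where "s = sin (pi * (real t / real p))"
  have p0: "p > 0" using assms by simp
  have z1: "z \<noteq> 1"
    using assms by (auto simp: z_def add_char_eq_1_iff dest!: zdvd_imp_le)
  have "1 / s \<le> real p / 2 * (1 / real t + 1 / real (p - t)) \<and> s > 0"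
  proof (cases "real t / real p \<le> 1/2")
    case True
    have 1: "2 * (real t / real p) \<le> s"
      unfolding s_def by (rule sin_pi_ge) (use True in auto)
    moreover have 2: "2 * (real t / real p) > 0" using assms by simp
    ultimately have "s > 0" by linarith
    have "1 / s \<le> 1 / (2 * (real t / real p))"
      by (rule frac_le[OF _ _ 2 1]) auto
    also have "\<dots> = real p / 2 * (1 / real t)" using assms by simp
    also have "\<dots> \<le> real p / 2 * (1 / real t + 1 / real (p - t))"
      by (intro mult_left_mono) auto
    finally show ?thesis using \<open>s > 0\<close> by simp
  next
    case False
    have "s = sin (pi * (real (p - t) / real p))"
    proof -
      have "pi * (real (p - t) / real p) = pi - pi * (real t / real p)"
        using assms by (simp add: of_nat_diff field_simps)
      then show ?thesis by (simp add: s_def)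
    qed
    then have 1: "2 * (real (p - t) / real p) \<le> s"
      by (simp only:, intro sin_pi_ge) (use False assms in \<open>auto simp: of_nat_diff field_simps\<close>)
    moreover have 2: "2 * (real (p - t) / real p) > 0" using assms by simp
    ultimately have "s > 0" by linarith
    have "1 / s \<le> 1 / (2 * (real (p - t) / real p))"
      by (rule frac_le[OF _ _ 2 1]) auto
    also have "\<dots> = real p / 2 * (1 / real (p - t))" using assms by simp
    also have "\<dots> \<le> real p / 2 * (1 / real t + 1 / real (p - t))"
      by (intro mult_left_mono) auto
    finally show ?thesis using \<open>s > 0\<close> by simp
  qed
  moreover have "cmod (\<Sum>m=1..M. add_char p (int t * int m)) \<le> 1 / s" if "s > 0"
  proof -
    have "(\<Sum>m=1..M. add_char p (int t * int m)) = (\<Sum>m<M. z ^ Suc m)"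
      unfolding z_def add_char_power
      by (rule sum.reindex_bij_witness[of _ Suc "\<lambda>m. m - 1"]) (auto simp: mult_ac)
    also have "\<dots> = z * ((z ^ M - 1) / (z - 1))"
      by (simp add: sum_distrib_left[symmetric] geometric_sum[OF z1])
    finally have "cmod (\<Sum>m=1..M. add_char p (int t * int m)) = cmod (z ^ M - 1) / cmod (z - 1)"
      by (simp add: norm_mult norm_divide z_def)
    also have "\<dots> \<le> 2 / cmod (z - 1)"
    proof (rule divide_right_mono)
      show "cmod (z ^ M - 1) \<le> 2"
        using norm_triangle_ineq4[of "z ^ M" 1] by (simp add: z_def norm_power)
    qed simp
    also have "cmod (z - 1) = 2 * s"
      using dist_exp_i_1[of "2 * pi * real t / real p"] that
      by (simp add: z_def add_char_def cis_conv_exp s_def)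
    finally show ?thesis by simp
  qed
  ultimately show ?thesis by linarith
qed

lemma harm_le_1_plus_ln:
  assumes "n > 0"
  shows "(harm n :: real) \<le> 1 + ln (real n)"
  using assms
proof (induction n rule: nat_induct_non_zero)
  case (Suc n)
  have "ln (real n / real (Suc n)) \<le> real n / real (Suc n) - 1"
    using Suc by (intro ln_le_minus_one) auto
  also have "\<dots> = - inverse (real (Suc n))" by (simp add: field_simps)
  finally show ?case using Suc by (simp add: harm_Suc ln_div)
qed (simp add: harm_def)

text \<open>The reflection t -> p - t exchanges the two reciprocals in the pointwise bound, so each
  of them sums to the same harmonic number.\<close>

lemma sum_cmod_interval_sum_le:
  assumes "p > 1"
  shows "(\<Sum>t=1..<p. cmod (\<Sum>m=1..M. add_char p (int t * int m))) \<le> real p * (1 + ln (real p))"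
proof -
  have h: "(\<Sum>t=1..<p. 1 / real t) = harm (p - 1)"
    unfolding harm_def using assms
    by (intro sum.cong) (auto simp: divide_inverse)
  have "(\<Sum>t=1..<p. cmod (\<Sum>m=1..M. add_char p (int t * int m)))
     \<le> (\<Sum>t=1..<p. real p / 2 * (1 / real t + 1 / real (p - t)))"
    by (intro sum_mono cmod_interval_sum_le) auto
  also have "\<dots> = real p / 2 * ((\<Sum>t=1..<p. 1 / real t) + (\<Sum>t=1..<p. 1 / real (p - t)))"
    by (simp only: sum_distrib_left[symmetric] sum.distrib)
  also have "(\<Sum>t=1..<p. 1 / real (p - t)) = (\<Sum>t=1..<p. 1 / real t)"
    by (rule sum.reindex_bij_witness[of _ "\<lambda>t. p - t" "\<lambda>t. p - t"]) auto
  also have "real p / 2 * ((\<Sum>t=1..<p. 1 / real t) + (\<Sum>t=1..<p. 1 / real t)) = real p * harm (p - 1)"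
    unfolding h by simp
  also have "\<dots> \<le> real p * (1 + ln (real p))"
  proof (rule mult_left_mono)
    have "harm (p - 1) \<le> 1 + ln (real (p - 1))"
      using assms by (intro harm_le_1_plus_ln) auto
    also have "ln (real (p - 1)) \<le> ln (real p)" using assms by simp
    finally show "harm (p - 1) \<le> 1 + ln (real p)" by simp
  qed simp
  finally show ?thesis .
qed

section \<open>Equidistribution of cosets among the multiples of \<open>e\<close> in an
  interval\<close>

lemma sum_dilation_mod:
  fixes f :: "nat \<Rightarrow> 'a::comm_monoid_add"
  assumes p: "prime p" and e: "coprime e p"
  shows "(\<Sum>t=1..<p. f ((t * e) mod p)) = (\<Sum>t=1..<p. f t)"
proof -
  define \<pi> where "\<pi> = (\<lambda>t. (t * e) mod p)"
  have inj: "inj_on \<pi> {1..<p}"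
  proof (rule inj_onI)
    fix x y assume xy: "x \<in> {1..<p}" "y \<in> {1..<p}" "\<pi> x = \<pi> y"
    then have "[x * e = y * e] (mod p)" by (simp add: \<pi>_def cong_def)
    then have "[x = y] (mod p)" using e by (metis cong_mult_rcancel_nat)
    then show "x = y" using xy by (simp add: cong_def)
  qed
  moreover have "\<pi> ` {1..<p} \<subseteq> {1..<p}"
  proof clarify
    fix t assume t: "t \<in> {1..<p}"
    have "\<not> p dvd t * e"
      using t e p by (auto simp: prime_dvd_mult_iff dest: dvd_imp_le)
    then have "\<pi> t \<noteq> 0" by (simp add: \<pi>_def mod_eq_0_iff_dvd)
    moreover have "\<pi> t < p" using prime_gt_0_nat[OF p] by (simp add: \<pi>_def)
    ultimately show "\<pi> t \<in> {1..<p}" by simp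
  qed
  ultimately have "bij_betw \<pi> {1..<p} {1..<p}"
    by (simp add: bij_betw_def endo_inj_surj)
  from sum.reindex_bij_betw[OF this, of f] show ?thesis by (simp add: \<pi>_def)
qed

text \<open>The condition on \<open>m\<close> is detected by additive characters. Frequency 0 yields
  the expected count; every other frequency contributes a coset sum of size at most sqrt p times an
  interval sum, and the latter are bounded on average over \<open>t\<close>.\<close>

lemma coset_interval_count:
  fixes c g e p M :: nat
  assumes p: "prime p" and c: "coprime c p" and g: "coprime g p" and e: "coprime e p"
  shows "\<bar>real (card {m\<in>{1..M}. \<exists>j<ord p g. [e * m = c * g ^ j] (mod p)})
            - real (ord p g) / real p * real M\<bar> \<le> sqrt (real p) * (1 + ln (real p))"
proof -
  define N where "N = ord p g"
  define A where "A = {m\<in>{1..M}. \<exists>j<N. [e * m = c * g ^ j] (mod p)}"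
  define F where "F = (\<lambda>t. \<Sum>j<N. add_char p (int t * int (c * g ^ j)))"
  define G where "G = (\<lambda>t. \<Sum>m=1..M. add_char p (int t * - int (e * m)))"
  define D where "D = (\<lambda>t. cmod (\<Sum>m=1..M. add_char p (int t * int m)))"
  have p1: "p > 1" using p prime_gt_1_nat by blast
  then have p0: "p > 0" by simp
  have "of_nat p * complex_of_real (card A) = of_nat p * (\<Sum>m=1..M. of_bool (m \<in> A))"
    by (simp add: A_def Int_def)
  also have "\<dots> = (\<Sum>m=1..M. of_nat p * of_bool (m \<in> A))"
    by (rule sum_distrib_left)
  also have "\<dots> = (\<Sum>m=1..M. \<Sum>j<N. \<Sum>t<p. add_char p (int t * (int (c * g ^ j) - int (e * m))))"
  proof (rule sum.cong)
    fix m assume m: "m \<in> {1..M}"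
    have dvd_iff: "int p dvd int (c * g ^ j) - int (e * m) \<longleftrightarrow> [e * m = c * g ^ j] (mod p)" for j
      by (metis cong_iff_dvd_diff cong_int_iff cong_sym)
    have "(\<Sum>j<N. \<Sum>t<p. add_char p (int t * (int (c * g ^ j) - int (e * m))))
        = (\<Sum>j<N. if [e * m = c * g ^ j] (mod p) then of_nat p else 0)"
      by (simp only: sum_add_char[OF p0] dvd_iff)
    also have "\<dots> = of_nat p * of_bool (m \<in> A)"
    \<comment> \<open>At most one exponent below the order satisfies the congruence, so the sum over
      \<open>j\<close> is \<open>p\<close> or 0 and never a larger multiple of
      \<open>p\<close>.\<close>
    proof (cases "m \<in> A")
      case True
      then obtain i where i: "i < N" "[e * m = c * g ^ i] (mod p)"
        by (auto simp: A_def)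
      have "[e * m = c * g ^ j] (mod p) \<longleftrightarrow> i = j" if "j < N" for j
      proof
        assume "[e * m = c * g ^ j] (mod p)"
        then have "[c * g ^ i = c * g ^ j] (mod p)"
          using i(2) cong_sym cong_trans by blast
        then show "i = j"
          using power_cong_less_ord_imp_eq[OF g _ _ _ c] i(1) that by (simp add: N_def)
      qed (use i in auto)
      then have "(\<Sum>j<N. if [e * m = c * g ^ j] (mod p) then of_nat p else 0)
          = (\<Sum>j<N. if i = j then of_nat p else (0::complex))"
        by (intro sum.cong) auto
      with i(1) True show ?thesis by (simp add: sum.delta)
    qed (use m in \<open>auto simp: A_def intro!: sum.neutral\<close>)
    finally show "of_nat p * of_bool (m \<in> A) =
        (\<Sum>j<N. \<Sum>t<p. add_char p (int t * (int (c * g ^ j) - int (e * m))))" ..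
  qed simp
  also have "\<dots> = (\<Sum>m=1..M. \<Sum>t<p. \<Sum>j<N. add_char p (int t * (int (c * g ^ j) - int (e * m))))"
    by (intro sum.cong refl sum.swap)
  also have "\<dots> = (\<Sum>t<p. \<Sum>m=1..M. \<Sum>j<N. add_char p (int t * (int (c * g ^ j) - int (e * m))))"
    by (rule sum.swap)
  also have "\<dots> = (\<Sum>t<p. G t * F t)"
    unfolding F_def G_def sum_product
    by (intro sum.cong refl) (simp add: add_char_add[symmetric] algebra_simps)
  \<comment> \<open>The frequency 0 is isolated as the main term.\<close>
  also have "{..<p} = insert 0 {1..<p}" using p0 by auto
  also have "(\<Sum>t\<in>insert 0 {1..<p}. G t * F t) = of_nat M * of_nat N + (\<Sum>t=1..<p. G t * F t)"
    by (simp add: F_def G_def)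
  finally have "of_nat p * complex_of_real (card A) - of_nat M * of_nat N = (\<Sum>t=1..<p. G t * F t)"
    by simp
  moreover have "of_nat p * complex_of_real (card A) - of_nat M * of_nat N
      = complex_of_real (real p * real (card A) - real M * real N)"
    by simp
  ultimately have "\<bar>real p * real (card A) - real M * real N\<bar> = cmod (\<Sum>t=1..<p. G t * F t)"
    by (metis norm_of_real real_norm_def)
  also have "\<dots> \<le> (\<Sum>t=1..<p. cmod (G t) * cmod (F t))"
    by (rule norm_sum[THEN order_trans]) (simp add: norm_mult)
  also have "\<dots> \<le> (\<Sum>t=1..<p. D ((t * e) mod p) * sqrt (real p))"
  proof (intro sum_mono mult_mono)
    fix t assume t: "t \<in> {1..<p}"
    show "cmod (F t) \<le> sqrt (real p)"
      unfolding F_def N_def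
      by (rule cmod_coset_sum_le[OF p c g]) (use t in \<open>auto dest!: zdvd_imp_le\<close>)
    \<comment> \<open>The factor \<open>e\<close> is absorbed into the frequency. As
      \<open>e\<close> is a unit, this only permutes the nonzero frequencies, so the final error
      does not depend on \<open>e\<close>.\<close>
    have "G t = cnj (\<Sum>m=1..M. add_char p (int ((t * e) mod p) * int m))"
      unfolding G_def cnj_sum cnj_add_char
    proof (intro sum.cong add_char_cong[OF p0] refl)
      fix m
      have "[(t * e) mod p * m = t * e * m] (mod p)"
        by (intro cong_scalar_right) (simp add: cong_def)
      then have "[int ((t * e) mod p) * int m = int t * int (e * m)] (mod int p)"
        by (metis cong_int_iff mult.assoc of_nat_mult)
      then show "[int t * - int (e * m) = - (int ((t * e) mod p) * int m)] (mod int p)"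
        by (simp add: cong_minus_minus_iff cong_sym_eq)
    qed
    then show "cmod (G t) \<le> D ((t * e) mod p)" by (simp only: D_def complex_mod_cnj)
  qed (simp_all add: D_def)
  also have "\<dots> = (\<Sum>t=1..<p. D t) * sqrt (real p)"
    by (simp only: sum_distrib_right[symmetric] sum_dilation_mod[OF p e])
  also have "\<dots> \<le> real p * (1 + ln (real p)) * sqrt (real p)"
    unfolding D_def by (intro mult_right_mono sum_cmod_interval_sum_le p1) simp
  finally have *: "\<bar>real p * real (card A) - real M * real N\<bar> \<le> real p * (sqrt (real p) * (1 + ln (real p)))"
    by (simp add: mult_ac)
  have "real (card A) - real N / real p * real M = (real p * real (card A) - real M * real N) / real p"
    using p0 by (simp add: field_simps)
  then have "\<bar>real (card A) - real N / real p * real M\<bar> = \<bar>real p * real (card A) - real M * real N\<bar> / real p"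
    by simp
  also have "\<dots> \<le> sqrt (real p) * (1 + ln (real p))"
    using * p0 by (simp add: field_simps)
  finally show ?thesis by (simp add: A_def N_def)
qed

section \<open>Inclusion-exclusion over the prime factors of \<open>n\<close>\<close>

lemma sum_Pow_sieve:
  fixes f :: "'b \<Rightarrow> 'a::comm_ring_1"
  assumes "finite P"
  shows "(\<Prod>r\<in>P. 1 - f r) = (\<Sum>S\<in>Pow P. (-1) ^ card S * prod f S)"
proof -
  have "(\<Prod>r\<in>P. - f r + 1) = (\<Sum>S\<in>Pow P. (\<Prod>r\<in>S. - f r) * (\<Prod>r\<in>P - S. 1))"
    by (rule prod_add[OF assms])
  then show ?thesis by (simp add: prod_uminus)
qed

lemma prod_primes_dvd_iff:
  fixes S :: "nat set"
  assumes "finite S" "\<And>r. r \<in> S \<Longrightarrow> prime r"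
  shows "\<Prod>S dvd x \<longleftrightarrow> (\<forall>r\<in>S. r dvd x)"
  using assms
proof (induction S rule: finite_induct)
  case (insert r S)
  have "coprime r (\<Prod>S)"
    using insert by (intro prod_coprime_right) (metis insertCI primes_coprime)
  then show ?case
    using insert by (auto dest: divides_mult dvd_mult_left dvd_mult_right)
qed simp

lemma coprime_iff_no_prime_factor_dvd:
  fixes n x :: nat
  assumes "n > 0"
  shows "coprime x n \<longleftrightarrow> (\<forall>r\<in>prime_factors n. \<not> r dvd x)"
proof -
  have "\<not> coprime x n \<longleftrightarrow> (\<exists>r. prime r \<and> r dvd x \<and> r dvd n)"
    by (metis coprime_iff_gcd_eq_1 gcd_greatest_iff not_prime_unit prime_factor_nat)
  then show ?thesis using assms by (auto simp: prime_factors_dvd)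
qed

text \<open>Legendre's sieve, with a set of prime factors \<open>S\<close> standing for the
  squarefree divisor \<open>\<Prod>S\<close>. The main terms n/d with alternating signs add up to
  the totient, and each of the 2^\<omega>(n) subsets costs at most \<open>E\<close>.\<close>

lemma sieve_lower_bound:
  fixes H :: "nat \<Rightarrow> bool"
  assumes n: "n > 0"
    and H: "\<And>d. d dvd n \<Longrightarrow>
      \<bar>real (card {m\<in>{1..n div d}. H (d * m)}) - \<delta> * real (n div d)\<bar> \<le> E"
  shows "\<delta> * real (totient n) - 2 ^ card (prime_factors n) * E
    \<le> real (card {x\<in>{1..n}. coprime x n \<and> H x})"
proof -
  define P where "P = prime_factors n"
  define C where "C = (\<lambda>d. real (card {m\<in>{1..n div d}. H (d * m)}))"
  have fin: "finite P" by (simp add: P_def)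
  have prime: "prime r" if "r \<in> P" for r using that by (auto simp: P_def)
  have dvd: "\<Prod>S dvd n" if "S \<subseteq> P" for S
    using that fin prime n
    by (subst prod_primes_dvd_iff) (auto intro: finite_subset simp: P_def dest: in_mono)
  \<comment> \<open>The multiples of \<open>d\<close> up to \<open>n\<close> are written as
    \<open>d * m\<close>, the form in which the hypothesis counts them.\<close>
  have C: "C d = (\<Sum>x=1..n. of_bool (d dvd x \<and> H x))" if "d dvd n" for d
  proof -
    have "bij_betw (\<lambda>m. d * m) {m\<in>{1..n div d}. H (d * m)} {x\<in>{1..n}. d dvd x \<and> H x}"
      using that n dvd_pos_nat[OF n that]
      by (intro bij_betwI[where g = "\<lambda>x. x div d"])
        (auto simp: less_eq_div_iff_mult_less_eq mult.commute elim!: dvdE)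
    then have "C d = real (card {x\<in>{1..n}. d dvd x \<and> H x})"
      by (simp add: C_def bij_betw_same_card)
    also have "\<dots> = (\<Sum>x=1..n. of_bool (d dvd x \<and> H x))"
      by (simp add: Int_def)
    finally show ?thesis .
  qed
  have "real (card {x\<in>{1..n}. coprime x n \<and> H x}) = (\<Sum>x=1..n. of_bool (coprime x n) * of_bool (H x))"
    by (simp add: Int_def flip: of_bool_conj)
  also have "\<dots> = (\<Sum>x=1..n. \<Sum>S\<in>Pow P. (-1) ^ card S * of_bool (\<Prod>S dvd x \<and> H x))"
  proof (rule sum.cong)
    fix x
    have "of_bool (coprime x n) = (\<Prod>r\<in>P. 1 - of_bool (r dvd x) :: real)"
      using fin by (auto simp: coprime_iff_no_prime_factor_dvd[OF n] P_def of_bool_def)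
    also have "\<dots> = (\<Sum>S\<in>Pow P. (-1) ^ card S * (\<Prod>r\<in>S. of_bool (r dvd x)))"
      by (rule sum_Pow_sieve[OF fin])
    also have "\<dots> = (\<Sum>S\<in>Pow P. (-1) ^ card S * of_bool (\<Prod>S dvd x))"
    proof (intro sum.cong refl arg_cong2[where f = "(*)"])
      fix S assume "S \<in> Pow P"
      then have S: "finite S" "\<And>r. r \<in> S \<Longrightarrow> prime r"
        using fin prime by (auto intro: finite_subset)
      then show "(\<Prod>r\<in>S. of_bool (r dvd x)) = (of_bool (\<Prod>S dvd x) :: real)"
        using prod_primes_dvd_iff[OF S] by (auto simp: of_bool_def)
    qed
    finally show "of_bool (coprime x n) * of_bool (H x) =
        (\<Sum>S\<in>Pow P. (-1) ^ card S * of_bool (\<Prod>S dvd x \<and> H x) :: real)"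
      by (simp add: sum_distrib_right of_bool_conj mult.assoc)
  qed simp
  also have "\<dots> = (\<Sum>S\<in>Pow P. \<Sum>x=1..n. (-1) ^ card S * of_bool (\<Prod>S dvd x \<and> H x))"
    by (rule sum.swap)
  also have "\<dots> = (\<Sum>S\<in>Pow P. (-1) ^ card S * C (\<Prod>S))"
    by (intro sum.cong refl) (simp add: C dvd sum_distrib_left)
  finally have card: "real (card {x\<in>{1..n}. coprime x n \<and> H x}) = (\<Sum>S\<in>Pow P. (-1) ^ card S * C (\<Prod>S))" .
  have "\<delta> * real (totient n) = \<delta> * real n * (\<Prod>r\<in>P. 1 - 1 / real r)"
    by (simp add: totient_formula2 P_def)
  also have "\<dots> = \<delta> * real n * (\<Sum>S\<in>Pow P. (-1) ^ card S * (\<Prod>r\<in>S. 1 / real r))"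
    by (simp only: sum_Pow_sieve[OF fin])
  also have "\<dots> = (\<Sum>S\<in>Pow P. \<delta> * real n * ((-1) ^ card S * (\<Prod>r\<in>S. 1 / real r)))"
    by (rule sum_distrib_left)
  also have "\<dots> = (\<Sum>S\<in>Pow P. (-1) ^ card S * (\<delta> * real (n div \<Prod>S)))"
  proof (intro sum.cong refl)
    fix S assume "S \<in> Pow P"
    then have "real (n div \<Prod>S) = real n / real (\<Prod>S)"
      by (intro real_of_nat_div dvd) auto
    also have "\<dots> = real n * (\<Prod>r\<in>S. 1 / real r)"
      by (simp add: prod_dividef)
    finally have eq: "real (n div \<Prod>S) = real n * (\<Prod>r\<in>S. 1 / real r)" .
    show "\<delta> * real n * ((-1) ^ card S * (\<Prod>r\<in>S. 1 / real r)) = (-1) ^ card S * (\<delta> * real (n div \<Prod>S))"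
      unfolding eq by (simp only: mult_ac)
  qed
  finally have main: "\<delta> * real (totient n) = (\<Sum>S\<in>Pow P. (-1) ^ card S * (\<delta> * real (n div \<Prod>S)))" .
  have "\<delta> * real (totient n) - real (card {x\<in>{1..n}. coprime x n \<and> H x})
      = (\<Sum>S\<in>Pow P. (-1) ^ card S * (\<delta> * real (n div \<Prod>S) - C (\<Prod>S)))"
    unfolding main card by (simp add: sum_subtractf right_diff_distrib)
  also have "\<dots> \<le> (\<Sum>S\<in>Pow P. \<bar>(-1) ^ card S * (\<delta> * real (n div \<Prod>S) - C (\<Prod>S))\<bar>)"
    by (rule sum_mono) simp
  also have "\<dots> \<le> (\<Sum>S\<in>Pow P. E)"
  proof (rule sum_mono)
    fix S assume "S \<in> Pow P"
    then show "\<bar>(-1) ^ card S * (\<delta> * real (n div \<Prod>S) - C (\<Prod>S))\<bar> \<le> E"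
      using H[OF dvd, of S] by (simp add: abs_mult power_abs C_def abs_minus_commute)
  qed
  also have "\<dots> = 2 ^ card P * E"
    using fin by (simp add: card_Pow)
  finally show ?thesis by (simp add: P_def)
qed

section \<open>Size estimates for the totient, the number of prime factors and the least odd prime
  factor\<close>

lemma prod_prime_factors_le:
  fixes n :: nat
  assumes "n > 0"
  shows "\<Prod>(prime_factors n) \<le> n"
proof -
  have "\<Prod>(prime_factors n) dvd n"
    by (subst prod_primes_dvd_iff) auto
  then show ?thesis using assms by (rule dvd_imp_le)
qed

lemma prime_less_23_nat:
  fixes r :: nat
  assumes "prime r" "r < 23"
  shows "r \<in> {2, 3, 5, 7, 11, 13, 17, 19}"
proof -
  have "r \<in> {..<23}" using assms by simp
  also have "{..<23} = {0, 1, 2, 3, 4, 5, 6, 7, 8, 9, 10, 11, 12, 13, 14, 15, 16, 17, 18, 19, 20, 21, 22::nat}"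
    by (auto simp: numeral_eq_Suc less_Suc_eq)
  finally show ?thesis using assms(1) by (auto simp: prime_nat_numeral_eq)
qed

text \<open>
  The local factors \<open>r ((1 - 1/r)/2)^4\<close> are at least \<open>1\<close> from \<open>r = 23\<close> on, and the
  product of the remaining ones is about \<open>1/516000 > 1/27^4\<close>.
\<close>

lemma totient_over_two_power_ge:
  fixes n :: nat
  assumes "n > 0"
  shows "real n ^ 3 \<le> (27 * (real (totient n) / 2 ^ card (prime_factors n))) ^ 4"
proof -
  define P where "P = prime_factors n"
  define T where "T = {2, 3, 5, 7, 11, 13, 17, 19 :: nat}"
  define f where "f = (\<lambda>r::nat. real r * ((1 - 1 / real r) / 2) ^ 4)"
  have fin: "finite P" "finite T" by (simp_all add: P_def T_def)
  have prime: "prime r" if "r \<in> P" for r using that by (auto simp: P_def)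
  have f_pos: "f r > 0" if "r \<in> P \<union> T" for r
  proof -
    have "r > 1" using that prime prime_gt_1_nat[of r] by (auto simp: T_def)
    then show ?thesis by (simp add: f_def)
  qed
  have f_ge: "f r \<ge> 1" if "r \<in> P - T" for r
  proof -
    have "r \<ge> 23" using that prime_less_23_nat[of r] prime[of r] by (force simp: T_def)
    \<comment> \<open>After this shift the difference of the two sides of 16 r^3 \<le> (r - 1)^4 has
      only positive coefficients.\<close>
    define y where "y = real r - 23"
    have y: "y \<ge> 0" "real r = y + 23" using \<open>r \<ge> 23\<close> by (simp_all add: y_def)
    have "(y + 22) ^ 4 - 16 * (y + 23) ^ 3 = y ^ 4 + 72 * y ^ 3 + 1800 * y ^ 2 + 17200 * y + 39584"
      by (simp add: eval_nat_numeral algebra_simps)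
    also have "\<dots> \<ge> 0" using y(1) by simp
    finally have "16 * real r ^ 3 \<le> (real r - 1) ^ 4" using y(2) by (simp add: add.commute)
    moreover have "f r = (real r - 1) ^ 4 / (16 * real r ^ 3)"
      using \<open>r \<ge> 23\<close> by (simp add: f_def field_simps power_divide power4_eq_xxxx power3_eq_cube)
    ultimately show ?thesis using \<open>r \<ge> 23\<close> by (simp add: le_divide_eq)
  qed
  have f_le: "f r \<le> 1" if "r \<in> T" for r
    using that by (auto simp: T_def f_def power_divide)
  \<comment> \<open>Dropping the primes of \<open>T\<close> outside \<open>P\<close> cannot lower
    the product, since their factors are at most 1; including the larger primes of \<open>P\<close>
    cannot lower it either.\<close>
  have "1 / 27 ^ 4 \<le> prod f T"
    by (simp add: T_def f_def power_divide)
  also have "\<dots> = prod f (P \<inter> T) * prod f (T - P)"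
    using fin by (subst prod.Int_Diff[of T _ P]) (simp_all add: Int_commute)
  also have "\<dots> \<le> prod f (P \<inter> T) * 1"
    by (intro mult_left_mono prod_le_1 prod_nonneg) (use f_pos f_le in \<open>auto intro: less_imp_le\<close>)
  also have "\<dots> \<le> prod f (P \<inter> T) * prod f (P - T)"
    by (intro mult_left_mono prod_ge_1 prod_nonneg) (use f_pos f_ge in \<open>auto intro: less_imp_le\<close>)
  also have "\<dots> = prod f P"
    using fin by (subst prod.Int_Diff[of P _ T]) simp_all
  \<comment> \<open>This is the radical of \<open>n\<close> times the fourth power of \<phi>(n) / (n
    2^\<omega>(n)); next the radical is replaced by \<open>n\<close>.\<close>
  also have "\<dots> = real (\<Prod>P) * ((\<Prod>r\<in>P. 1 - 1 / real r) / 2 ^ card P) ^ 4"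
    by (simp only: f_def prod.distrib prod_power_distrib[symmetric] prod_dividef) simp
  also have "\<dots> \<le> real n * ((\<Prod>r\<in>P. 1 - 1 / real r) / 2 ^ card P) ^ 4"
    using prod_prime_factors_le[OF assms] by (intro mult_right_mono of_nat_le_iff[THEN iffD2]) (simp_all add: P_def)
  finally have *: "1 / 27 ^ 4 \<le> real n * ((\<Prod>r\<in>P. 1 - 1 / real r) / 2 ^ card P) ^ 4" .
  have "real n ^ 3 = 27 ^ 4 * real n ^ 3 * (1 / 27 ^ 4)" by simp
  also have "\<dots> \<le> 27 ^ 4 * real n ^ 3 * (real n * ((\<Prod>r\<in>P. 1 - 1 / real r) / 2 ^ card P) ^ 4)"
    by (rule mult_left_mono[OF *]) simp
  also have "\<dots> = (27 * (real n * (\<Prod>r\<in>P. 1 - 1 / real r) / 2 ^ card P)) ^ 4"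
    by (simp add: power_mult_distrib power_divide power4_eq_xxxx power3_eq_cube)
  finally show ?thesis by (simp add: totient_formula2 P_def)
qed

text \<open>Each prime factor is at least 2, so 2^\<omega>(n) is at most the radical of
  \<open>n\<close>; the constant comes from ln 2 \<ge> 2/3.\<close>

lemma card_prime_factors_le_ln:
  fixes n :: nat
  assumes "n > 0"
  shows "real (card (prime_factors n)) \<le> 3 / 2 * ln (real n)"
proof -
  have "real (2 ^ card (prime_factors n)) \<le> real n"
  proof -
    have "2 ^ card (prime_factors n) = (\<Prod>r\<in>prime_factors n. 2::nat)" by simp
    also have "\<dots> \<le> \<Prod>(prime_factors n)"
      by (rule prod_mono) (auto intro: prime_ge_2_nat)
    also have "\<dots> \<le> n" using assms by (rule prod_prime_factors_le)
    finally show ?thesis by (simp only: of_nat_le_iff)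
  qed
  then have "ln (real (2 ^ card (prime_factors n))) \<le> ln (real n)"
    using assms by (subst ln_le_cancel_iff) auto
  then have "real (card (prime_factors n)) * ln 2 \<le> ln (real n)"
    by (simp add: ln_realpow)
  moreover have "real (card (prime_factors n)) * (2 / 3) \<le> real (card (prime_factors n)) * ln 2"
    by (intro mult_left_mono ln2_ge_two_thirds) simp
  ultimately show ?thesis by simp
qed

text \<open>The prime 2 contributes 1/2 to \<phi>(n)/n, so the odd primes contribute at most 9/11.
  If \<open>l\<close> is the least of k odd prime factors, Bernoulli's inequality bounds their
  contribution below by (1 - 1/l)^k \<ge> 1 - k/l, whence k/l \<ge> 2/11.\<close>

lemma small_odd_prime_factor:
  fixes n :: nat
  assumes n: "n > 0" "even n" and tot: "real (totient n) / real n \<le> 9 / 22"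
  obtains l where "prime l" "odd l" "l dvd n" "real l \<le> 11 / 2 * real (card (prime_factors n))"
proof -
  define P where "P = prime_factors n"
  define Q where "Q = P - {2}"
  have fin: "finite P" "finite Q" by (simp_all add: P_def Q_def)
  have P: "P = insert 2 Q" "2 \<notin> Q" using n by (auto simp: P_def Q_def prime_factors_dvd)
  have Q: "prime r \<and> r dvd n \<and> odd r" if "r \<in> Q" for r
    using that n primes_dvd_imp_eq[of 2 r] by (auto simp: Q_def P_def)
  have "real (totient n) / real n = (\<Prod>r\<in>P. 1 - 1 / real r)"
    using n by (simp add: totient_formula2 P_def)
  also have "\<dots> = 1 / 2 * (\<Prod>r\<in>Q. 1 - 1 / real r)"
    using P fin by simp
  finally have prod: "(\<Prod>r\<in>Q. 1 - 1 / real r) \<le> 9 / 11" using tot by linarith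
  then have "Q \<noteq> {}" by auto
  define l where "l = Min Q"
  have l: "l \<in> Q" "\<And>r. r \<in> Q \<Longrightarrow> l \<le> r"
    using \<open>Q \<noteq> {}\<close> fin by (simp_all add: l_def)
  have l1: "l > 1" using Q[OF l(1)] prime_gt_1_nat by blast
  have "1 + real (card Q) * (- 1 / real l) \<le> (1 + - 1 / real l) ^ card Q"
    by (rule Bernoulli_inequality) (use l1 in simp)
  also have "\<dots> = (\<Prod>r\<in>Q. 1 - 1 / real l)" by simp
  also have "\<dots> \<le> (\<Prod>r\<in>Q. 1 - 1 / real r)"
    by (rule prod_mono) (use l l1 in \<open>force simp: frac_le\<close>)
  finally have "2 / 11 \<le> real (card Q) / real l" using prod by simp
  then have "real l \<le> 11 / 2 * real (card Q)" using l1 by (simp add: field_simps)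
  also have "\<dots> \<le> 11 / 2 * real (card P)" using P fin by simp
  finally show ?thesis using that[of l] Q[OF l(1)] by (simp add: P_def)
qed

text \<open>From exp u \<ge> 2u with u = x/100 \<ge> 1, the 25th power gives exp(x/4) \<ge> 2^25
  u^25 \<ge> 2^25 u^2, and 2^25 / 100^2 > 3355 exceeds 1782 with room for the linear term.\<close>

lemma square_less_exp_quarter:
  fixes x :: real
  assumes "x \<ge> 100"
  shows "1782 * x * (1 + x) < exp (x / 4)"
proof -
  have "x / 100 \<le> exp (x / 100 - 1)"
    using exp_ge_add_one_self[of "x / 100 - 1"] by simp
  moreover have "(2::real) \<le> exp 1"
    using exp_ge_add_one_self[of 1] by simp
  ultimately have "2 * (x / 100) \<le> exp 1 * exp (x / 100 - 1)"
    using assms by (intro mult_mono) auto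
  then have "2 * (x / 100) \<le> exp (x / 100)" by (simp add: exp_add[symmetric])
  then have "(2 * (x / 100)) ^ 25 \<le> exp (x / 100) ^ 25"
    using assms by (intro power_mono) auto
  moreover have "exp (x / 100) ^ 25 = exp (x / 4)"
    by (simp add: exp_of_nat_mult[symmetric])
  moreover have "2 ^ 25 * (x / 100) ^ 2 \<le> (2 * (x / 100)) ^ 25"
    unfolding power_mult_distrib using assms by (intro mult_left_mono power_increasing) auto
  moreover have "1782 * x * (1 + x) < 2 ^ 25 * (x / 100) ^ 2"
  proof -
    have "100 * x \<le> x * x" "0 < x * x" using assms by simp_all
    then show ?thesis by (simp add: power2_eq_square algebra_simps)
  qed
  ultimately show ?thesis by linarith
qed

section \<open>Constructing the non-residue and proving the theorem\<close>

lemma QNRNP_odd_multiple_power: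
  fixes p a l i x :: nat
  assumes p: "prime p" "p > 2" and a: "residue_primroot p a"
    and l: "odd l" "l > 1" "l dvd p - 1" and i: "odd i"
    and x: "[x = a ^ (l * i)] (mod p)"
  shows "QNRNP p (int x)"
proof -
  have ord_a: "ord p a = p - 1" and cop_a: "coprime a p"
    using a p by (simp_all add: residue_primroot_def totient_prime coprime_commute)
  have cop: "coprime x p"
    using cong_imp_coprime[OF cong_sym[OF x]] cop_a by simp
  have ev: "even (p - 1)" using p prime_odd_nat by simp
  have x_power: "p - 1 dvd l * i * k" if "[x ^ k = 1] (mod p)" for k
  proof -
    have "[a ^ (l * i * k) = 1] (mod p)"
      using cong_trans[OF cong_sym[OF cong_pow[OF x]] that] by (simp add: power_mult)
    then show ?thesis by (simp only: ord_divides ord_a)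
  qed
  \<comment> \<open>By Euler's criterion a residue would satisfy x^((p-1)/2) = 1, forcing the
    exponent \<open>l * i\<close> of the primitive root to be even.\<close>
  have "\<not> QuadRes (int p) (int x)"
  proof
    assume Q: "QuadRes (int p) (int x)"
    have "\<not> p dvd x" using cop p(1) by (metis coprime_absorb_right not_prime_unit coprime_commute)
    then have "Legendre (int x) (int p) = 1"
      using Q by (simp add: Legendre_def cong_0_iff)
    then have "[1 = int x ^ ((p - 1) div 2)] (mod int p)"
      using euler_criterion[OF p] by metis
    then have "[x ^ ((p - 1) div 2) = 1] (mod p)"
      by (metis cong_int_iff cong_sym of_nat_1 of_nat_power)
    then have "p - 1 dvd l * i * ((p - 1) div 2)" by (rule x_power)
    then have "2 * ((p - 1) div 2) dvd l * i * ((p - 1) div 2)" using ev by simp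
    then have "even (l * i)" using p by simp
    then show False using l i by simp
  qed
  \<comment> \<open>As an \<open>l\<close>-th power, \<open>x\<close> is killed by the exponent
    (p-1)/l, which is too small for a generator.\<close>
  moreover have "\<not> residue_primroot p x"
  proof
    assume "residue_primroot p x"
    then have ord_x: "ord p x = p - 1" using p by (simp add: residue_primroot_def totient_prime)
    have "[x ^ ((p - 1) div l) = (a ^ (p - 1)) ^ i] (mod p)"
      using cong_pow[OF x, of "(p - 1) div l"] l(3)
      by (simp add: power_mult[symmetric] mult_ac)
    also have "[(a ^ (p - 1)) ^ i = 1 ^ i] (mod p)"
      using ord[of a p] by (intro cong_pow) (simp add: ord_a)
    finally have "p - 1 dvd (p - 1) div l" by (simp add: ord_divides' ord_x)
    moreover have "(p - 1) div l > 0" using l p by (simp add: div_greater_zero_iff dvd_imp_le)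
    moreover have "(p - 1) div l < p - 1" using l p by (intro div_less_dividend) auto
    ultimately show False by (auto dest: dvd_imp_le)
  qed
  moreover have "nat (int x mod int p) = x mod p"
    by (simp flip: of_nat_mod)
  ultimately show ?thesis
    using cop by (simp add: QNRNP_def primroot_mod_def coprime_int_iff)
qed

lemma exists_QNRNP_coprime_pred:
  fixes p :: nat
  assumes p: "prime p" and p_large: "ln (real p) \<ge> 100"
    and tot: "real (totient (p - 1)) / real (p - 1) \<le> 9 / 22"
  obtains x where "1 < x" "x < p - 1" "coprime x (p - 1)" "QNRNP p (int x)"
proof -
  define n where "n = p - 1"
  define L where "L = ln (real p)"
  define \<omega> where "\<omega> = card (prime_factors n)"
  \<comment> \<open>This is the fourth root of \<open>p\<close>; it turns the comparison of
    fractional powers into one between y^2 and y^3.\<close>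
  define y where "y = exp (L / 4)"
  have p2: "p > 2"
  proof (rule ccontr)
    assume "\<not> p > 2"
    then have "ln (real p) \<le> real p - 1"
      using prime_gt_0_nat[OF p] by (intro ln_le_minus_one) auto
    then show False using p_large \<open>\<not> p > 2\<close> by simp
  qed
  have n: "n > 0" "even n" "real n \<ge> real p / 2" "n \<le> p"
    using p p2 prime_odd_nat by (auto simp: n_def of_nat_diff)
  obtain l where l: "prime l" "odd l" "l dvd n" "real l \<le> 11 / 2 * real \<omega>"
    using small_odd_prime_factor[OF n(1,2)] tot unfolding \<omega>_def n_def by metis
  have l1: "l > 1" using l(1) prime_gt_1_nat by blast
  obtain a where a: "residue_primroot p a"
    using prime_primitive_root_exists[OF _ p] p2 by auto
  have ord_a: "ord p a = n" and cop_a: "coprime a p"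
    using a p by (simp_all add: residue_primroot_def totient_prime coprime_commute n_def)
  define N where "N = ord p (a ^ (2 * l))"
  \<comment> \<open>Since \<open>a\<close> has order \<open>n\<close>, the exponent
    \<open>2 * l * N\<close> that kills it is a positive multiple of \<open>n\<close>.\<close>
  have N: "real n \<le> real N * (2 * real l)"
  proof -
    have "[a ^ (2 * l * N) = 1] (mod p)"
      using ord[of "a ^ (2 * l)" p] by (simp add: N_def power_mult)
    then have "n dvd 2 * l * N" by (simp only: ord_divides ord_a)
    moreover have "N > 0" using cop_a by (simp add: N_def coprime_commute)
    ultimately have "n \<le> 2 * l * N" using l1 by (intro dvd_imp_le) auto
    then have "real n \<le> real (2 * l * N)" by (simp only: of_nat_le_iff)
    then show ?thesis by (simp add: mult_ac)
  qed
  define H where "H = (\<lambda>x. \<exists>j<N. [x = a ^ l * (a ^ (2 * l)) ^ j] (mod p))"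
  define E where "E = sqrt (real p) * (1 + L)"
  have count: "real N / real p * real (totient n) - 2 ^ \<omega> * E
      \<le> real (card {x\<in>{1..n}. coprime x n \<and> H x})"
    unfolding \<omega>_def
  proof (rule sieve_lower_bound[OF n(1)])
    fix d assume "d dvd n"
    have "coprime d p"
    proof -
      have "coprime n p" using coprime_diff_one_left_nat[of p] p2 by (simp add: n_def)
      with \<open>d dvd n\<close> show ?thesis by (rule coprime_divisors[OF _ dvd_refl])
    qed
    from coset_interval_count[OF p _ _ this, of "a ^ l" "a ^ (2 * l)" "n div d"] cop_a
    show "\<bar>real (card {m\<in>{1..n div d}. H (d * m)}) - real N / real p * real (n div d)\<bar> \<le> E"
      by (simp add: H_def N_def E_def L_def)
  qed
  have "2 ^ \<omega> * E < real N / real p * real (totient n)"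
  proof -
    \<comment> \<open>The desired inequality is divided by \<open>2 ^ \<omega>\<close>, which leaves
      the quantity bounded below by \<open>totient_over_two_power_ge\<close>.\<close>
    define \<Phi> where "\<Phi> = real (totient n) / 2 ^ \<omega>"
    have y: "y > 0" "y ^ 4 = real p"
      using p2 by (simp_all add: y_def L_def exp_of_nat_mult[symmetric])
    have "(y ^ 3 / 2) ^ 4 \<le> (y ^ 4 / 2) ^ 3"
      using y(1) by (simp add: power_divide flip: power_mult)
    also have "\<dots> \<le> real n ^ 3" using n y by (intro power_mono) auto
    also have "\<dots> \<le> (27 * \<Phi>) ^ 4"
      unfolding \<Phi>_def \<omega>_def by (rule totient_over_two_power_ge[OF n(1)])
    finally have "y ^ 3 / 2 \<le> 27 * \<Phi>"
      by (subst (asm) power_mono_iff) (use y(1) in \<open>simp_all add: \<Phi>_def\<close>)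
    have "ln (real n) \<le> L" using n by (simp add: L_def)
    then have "real \<omega> \<le> 3 / 2 * L"
      using card_prime_factors_le_ln[OF n(1)] by (simp add: \<omega>_def)
    then have l_le: "real l \<le> 33 / 4 * L" using l(4) by simp
    \<comment> \<open>Here 216 = 4 * 54: the 54 is from y^3 \<le> 54 \<open>\<Phi>\<close>, the 4
      from p \<le> 2 n \<le> 4 l N. Together with 33/4 it gives the 1782 of
      \<open>square_less_exp_quarter\<close>.\<close>
    have "216 * real l * (1 + L) \<le> 216 * (33 / 4 * L) * (1 + L)"
      using l_le p_large by (intro mult_right_mono mult_left_mono) (auto simp: L_def)
    also have "\<dots> < y"
      using square_less_exp_quarter[of L] p_large by (simp add: L_def y_def)
    finally have "216 * real l * (1 + L) < y" .
    then have "y\<^sup>2 * (216 * real l * (1 + L)) < y\<^sup>2 * y"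
      using y by (intro mult_strict_left_mono) auto
    also have "\<dots> = y ^ 3" by (simp add: power2_eq_square power3_eq_cube)
    also have "\<dots> \<le> 54 * \<Phi>" using \<open>y ^ 3 / 2 \<le> 27 * \<Phi>\<close> by simp
    also have "y\<^sup>2 * (216 * real l * (1 + L)) = 54 * (4 * real l * (y\<^sup>2 * (1 + L)))"
      by (simp add: algebra_simps)
    finally have "4 * real l * (y\<^sup>2 * (1 + L)) < \<Phi>" by linarith
    moreover have "sqrt (real p) = y\<^sup>2"
      using y by (intro real_sqrt_unique) (simp_all flip: power_mult)
    ultimately have "4 * real l * E < \<Phi>" by (simp add: E_def)
    then have "E < \<Phi> / (4 * real l)" using l1 by (simp add: field_simps)
    also have "\<dots> = 1 / (4 * real l) * \<Phi>" by simp
    also have "\<dots> \<le> real N / real p * \<Phi>"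
    proof (rule mult_right_mono)
      have "real p \<le> real N * (4 * real l)" using N n by linarith
      then show "1 / (4 * real l) \<le> real N / real p" using l1 p2 by (simp add: field_simps)
    qed (simp add: \<Phi>_def)
    finally have "E < real N / real p * real (totient n) / 2 ^ \<omega>"
      by (simp add: \<Phi>_def)
    then have "E * 2 ^ \<omega> < real N / real p * real (totient n)"
      by (subst (asm) pos_less_divide_eq) simp_all
    then show ?thesis by (simp only: mult.commute)
  qed
  with count have "0 < real (card {x\<in>{1..n}. coprime x n \<and> H x})" by linarith
  then have "card {x\<in>{1..n}. coprime x n \<and> H x} \<noteq> 0" by (intro notI) (simp only: of_nat_0)
  then obtain x j where x: "x \<in> {1..n}" "coprime x n" "[x = a ^ l * (a ^ (2 * l)) ^ j] (mod p)"
    by (auto simp: card_eq_0_iff H_def)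
  \<comment> \<open>Elements of the coset are exactly powers of \<open>a\<close> whose exponent is
    an odd multiple of \<open>l\<close>.\<close>
  have "a ^ l * (a ^ (2 * l)) ^ j = a ^ (l * (2 * j + 1))"
    by (simp add: power_add power_mult[symmetric] mult_ac distrib_left)
  then have Q: "QNRNP p (int x)"
    using QNRNP_odd_multiple_power[OF p p2 a l(2) l1 _ _ , of "2 * j + 1" x] l(3) x(3) by (simp add: n_def)
  have "x \<noteq> 1"
  proof
    assume "x = 1"
    then have "[1\<^sup>2 = int x] (mod int p)" by simp
    then show False using Q unfolding QNRNP_def QuadRes_def by blast
  qed
  \<comment> \<open>Since n > 1, it is not coprime to itself.\<close>
  moreover have "x \<noteq> n" using x(2) n p2 by (auto simp: n_def)
  ultimately show ?thesis using that[of x] x(1,2) Q by (simp add: n_def)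
qed

theorem theorem2:
  fixes q p :: nat and \<epsilon> :: real
  assumes "q \<ge> 1"
    and "\<epsilon> \<in> {1/11..<1/2}"
    and "prime p"
    and "[p = 1] (mod q)"
    and "ln (ln (real p)) > ln 6.83 / (1/2 - \<epsilon>)"
    and "real (totient (p - 1)) / real (p - 1) \<le> 1/2 - \<epsilon>"
  shows "(\<exists>g::int. 1 < g \<and> g < int p - 1 \<and> gcd g (int ((p - 1) div q)) = 1 \<and> QNRNP p g)
    \<and> (q = 1 \<longrightarrow> (\<exists>g::int. 1 < g \<and> g < int p - 1 \<and> gcd g (int (p - 1)) = 1 \<and> QNRNP p g))"
proof -
  have p1: "p > 1" using assms(3) prime_gt_1_nat by blast
  \<comment> \<open>The largest value of 1/2 - \<epsilon> is 9/22, so the claim ln p > 100 amounts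
    to the numerical fact 100^9 \<le> 6.83^22.\<close>
  have "9 * ln (100::real) = ln (100 ^ 9)" by (subst ln_realpow) simp_all
  also have "\<dots> \<le> ln (6.83 ^ 22)" by (subst ln_le_cancel_iff) (simp_all add: power_divide)
  also have "\<dots> = 22 * ln 6.83" by (subst ln_realpow) simp_all
  finally have "ln 100 \<le> ln 6.83 / (9 / 22 :: real)" by simp
  also have "\<dots> \<le> ln 6.83 / (1/2 - \<epsilon>)"
    using assms(2) by (intro divide_left_mono) auto
  also have "\<dots> < ln (ln (real p))" by (rule assms(5))
  finally have "100 \<le> ln (real p)" using p1 by (simp add: ln_less_cancel_iff)
  moreover have "real (totient (p - 1)) / real (p - 1) \<le> 9 / 22" using assms(2) by (intro order_trans[OF assms(6)]) auto
  ultimately obtain x where x: "1 < x" "x < p - 1" "coprime x (p - 1)" "QNRNP p (int x)"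
    using exists_QNRNP_coprime_pred[OF assms(3)] by blast
  have "q dvd p - 1"
    using assms(4) p1 by (simp add: cong_altdef_nat cong_sym_eq)
  \<comment> \<open>Coprimality to p - 1 passes to its divisor (p - 1)/q, so one witness serves
    every \<open>q\<close>.\<close>
  then have "(p - 1) div q dvd p - 1" by (intro dvdI[of _ _ q]) simp
  then have "coprime x ((p - 1) div q)"
    by (rule coprime_divisors[OF dvd_refl _ x(3)])
  then have "gcd (int x) (int ((p - 1) div q)) = 1" by (simp only: coprime_iff_gcd_eq_1[symmetric] coprime_int_iff)
  moreover have "gcd (int x) (int (p - 1)) = 1" using x(3) by (simp only: coprime_iff_gcd_eq_1[symmetric] coprime_int_iff)
  moreover have "1 < int x" "int x < int p - 1" using x(1,2) by auto
  ultimately show ?thesis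
    using x(4) by - (intro conjI impI exI[of _ "int x"]; assumption)
qed

end
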